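(* Let $U\subseteq\mathbb{C}$ be a domain, let $f$ be a nonconstant analytic function on $U$, and let $a\in U$. Let $B_t$ be a planar Brownian motion starting at $a$, and let $\tau$ be an (a.s. finite) stopping time such that almost surely $\{B_t:0\le t\le\tau\}\subset U$. Suppose $\gamma$ is a smooth curve in $U$ such that $B_\tau\in\gamma$ almost surely, and that $B_\tau$ has a density $\rho^a_\tau$ with respect to arclength on $\gamma$. Then $f(B_\tau)$, which lies on $f(\gamma)$ almost surely, has a density $\rho^{f(a)}_{\hat\tau}$ with respect to arclength on $f(\gamma)$, and for (arclength-almost every) $w\in f(\gamma)$ $$\rho^{f(a)}_{\hat\tau}(w)=\sum_{z\in f^{-1}(w)\cap\gamma}\frac{\rho^a_\tau(z)}{|f'(z)|}.$$
   Context: For a smooth curve $\gamma$ (parameterized by arclength, regarded as a set of points carrying arclength measure $ds$, i.e. one-dimensional Hausdorff measure) and a stopping time $\tau$ with $B_\tau\in\gamma$ a.s., $\rho^a_\tau$ denotes the density, when it exists, of $B_\tau$ with respect to $ds$: $P_a(B_\tau\in A)=\int_A\rho^a_\tau\,ds$ for every measurable $A\subseteq\gamma$. By Lévy's theorem, $f(B_t)$ stopped at $\tau$ is a time-changed Brownian motion: there are a Brownian motion $\hat B$ started at $f(a)$ and a stopping time $\hat\tau$ (the image of $\tau$ under the time change) with $\hat B_{\hat\tau}=f(B_\tau)$. The symbol $\rho^{f(a)}_{\hat\tau}$ denotes the density of $\hat B_{\hat\tau}=f(B_\tau)$ with respect to arclength on $f(\gamma)$. *)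

theory Defs
  imports "HOL-Complex_Analysis.Complex_Analysis" "HOL-Probability.Probability"
begin

section \<open>Arclength: one-dimensional Hausdorff measure\<close>

text \<open>
  The covering sets are required to be bounded because \<^const>\<open>diameter\<close> is unspecified on
  unbounded sets.
\<close>

definition hausdorff1_content :: "real \<Rightarrow> 'a::metric_space set \<Rightarrow> ennreal" where
  "hausdorff1_content \<delta> A =
     (INF C\<in>{C :: nat \<Rightarrow> 'a set. A \<subseteq> (\<Union>i. C i) \<and> (\<forall>i. bounded (C i) \<and> diameter (C i) \<le> \<delta>)}.
        \<Sum>i. ennreal (diameter (C i)))"

definition hausdorff1_outer :: "'a::metric_space set \<Rightarrow> ennreal" where
  "hausdorff1_outer A = (SUP \<delta>\<in>{0<..}. hausdorff1_content \<delta> A)"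

text \<open>
  \<^const>\<open>measure_of\<close> returns the zero measure when its set function is not countably additive;
  this does not happen here, since \<^const>\<open>hausdorff1_outer\<close> is a metric outer measure, so that
  all Borel sets are measurable in the sense of Caratheodory.
\<close>

definition hausdorff1 :: "'a::metric_space measure" where
  "hausdorff1 = measure_of UNIV (sets borel) hausdorff1_outer"

text \<open>Arclength on a Borel set of points; multiple points of a curve are counted once.\<close>

definition arclength_on :: "complex set \<Rightarrow> complex measure" where
  "arclength_on C = restrict_space hausdorff1 C"

text \<open>
  A smooth curve is the trace of a unit speed \<open>C\<^sup>1\<close> path over an interval, which may be
  unbounded and need not be closed. The path need not be injective, so that closed and
  self-intersecting curves are included. If the interval contains an end point,
  \<^const>\<open>C1_differentiable_on\<close> asks for a two-sided derivative there; this is no restriction, as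
  a path that is \<open>C\<^sup>1\<close> up to the end point can be continued beyond it, and only the values of the
  path on the interval matter for the trace.
\<close>

definition smooth_curve :: "complex set \<Rightarrow> bool" where
  "smooth_curve C \<longleftrightarrow>
     (\<exists>(g :: real \<Rightarrow> complex) I.
        is_interval I \<and> interior I \<noteq> {} \<and> g C1_differentiable_on I \<and>
        (\<forall>s\<in>I. norm (vector_derivative g (at s)) = 1) \<and> C = g ` I)"


section \<open>Densities with respect to arclength\<close>

text \<open>
  \<open>X\<close> may be meaningful only almost surely (e.g. a function of a process that is only almost surely
  in its domain), so events are taken in the completion of the probability space.
\<close>

definition has_arclength_density ::
  "'w measure \<Rightarrow> ('w \<Rightarrow> complex) \<Rightarrow> complex set \<Rightarrow> (complex \<Rightarrow> ennreal) \<Rightarrow> bool" where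
  "has_arclength_density M X C \<rho> \<longleftrightarrow>
     X \<in> borel_measurable (completion M) \<and>
     \<rho> \<in> borel_measurable (arclength_on C) \<and>
     (\<forall>A\<in>sets (arclength_on C).
        emeasure (completion M) (X -` A \<inter> space M) = (\<integral>\<^sup>+z\<in>A. \<rho> z \<partial>arclength_on C))"


section \<open>Planar Brownian motion\<close>

text \<open>
  Filtrations are indexed by \<^typ>\<open>ennreal\<close>, so that \<^const>\<open>stopping_time\<close> covers stopping times
  that take the value \<open>\<infinity>\<close>. Processes are indexed by \<^typ>\<open>real\<close>, and only their values at times
  \<open>t \<ge> 0\<close> matter. The natural filtration is one possible choice of \<open>F\<close>.
\<close>

definition planar_brownian_motion ::
  "'w measure \<Rightarrow> (ennreal \<Rightarrow> 'w measure) \<Rightarrow> complex \<Rightarrow> (real \<Rightarrow> 'w \<Rightarrow> complex) \<Rightarrow> bool" where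
  "planar_brownian_motion M F a B \<longleftrightarrow>
     prob_space M \<and>
     filtration (space M) F \<and> (\<forall>t. subalgebra M (F t)) \<and>
     (\<forall>t\<ge>0. B t \<in> borel_measurable (F (ennreal t))) \<and>
     (AE \<omega> in M. B 0 \<omega> = a) \<and>
     (AE \<omega> in M. continuous_on {0..} (\<lambda>t. B t \<omega>)) \<and>
     (\<forall>s t. 0 \<le> s \<and> s < t \<longrightarrow>
        prob_space.indep_set M (sets (F (ennreal s)))
          {(\<lambda>\<omega>. B t \<omega> - B s \<omega>) -` A \<inter> space M |A. A \<in> sets borel} \<and>
        prob_space.indep_var M
          borel (\<lambda>\<omega>. Re (B t \<omega> - B s \<omega>)) borel (\<lambda>\<omega>. Im (B t \<omega> - B s \<omega>)) \<and>
        distributed M lborel (\<lambda>\<omega>. Re (B t \<omega> - B s \<omega>)) (normal_density 0 (sqrt (t - s))) \<and>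
        distributed M lborel (\<lambda>\<omega>. Im (B t \<omega> - B s \<omega>)) (normal_density 0 (sqrt (t - s))))"

definition stopped_at :: "(real \<Rightarrow> 'w \<Rightarrow> complex) \<Rightarrow> ('w \<Rightarrow> ennreal) \<Rightarrow> 'w \<Rightarrow> complex" where
  "stopped_at B \<tau> \<omega> = B (enn2real (\<tau> \<omega>)) \<omega>"

end

theory Submission
  imports Defs
begin

text \<open>
  Write \<open>X\<close> for the stopped process. The law of \<open>f(X)\<close> is the image under \<open>f\<close> of the law of \<open>X\<close>,
  so the formula is a change of variables for arclength, and arclength is one-dimensional Hausdorff
  measure \<open>H\<close>. An analytic function is infinitesimally a similarity with ratio \<open>|f'(z)|\<close>, and
  a similarity of ratio \<open>m\<close> multiplies \<open>H\<close> by \<open>m\<close> on \<^emph>\<open>every\<close> set, whatever its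
  shape. Hence \<open>H(f(E))\<close> is the integral of \<open>|f'|\<close> over \<open>E\<close> for every Borel set \<open>E\<close> contained in an
  open set on which \<open>f\<close> is injective (\<open>hausdorff1_conformal_image\<close>).

  Away from the zeros of \<open>f'\<close> the domain splits into countably many Borel pieces on which \<open>f\<close> is
  injective. Adding the change of variables over the pieces gives the area formula
  (\<open>area_formula_hausdorff1\<close>): the integral over \<open>w\<close> of the sum of \<open>h\<close> over the fibre of \<open>w\<close> equals
  the integral of \<open>h |f'|\<close>. With \<open>h = \<rho> / |f'|\<close> on the part of \<open>\<gamma>\<close> that \<open>f\<close> maps
  into a set \<open>A\<close>, the right-hand side is the probability of \<open>f(X) \<in> A\<close> and the left-hand side is the
  integral over \<open>A\<close> of the sum in the theorem, which is therefore a density. The zeros of \<open>f'\<close> are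
  countable, so they and their images carry no arclength.

  Any two densities of a finite measure agree almost everywhere, so every density is given by
  the formula. All of this needs \<open>H\<close> to be countably additive on Borel sets
  (\<open>emeasure_hausdorff1\<close>), and \<open>\<gamma>\<close> and \<open>f(\<gamma>)\<close> to be Borel sets, which they are as countable
  unions of compact sets.
\<close>

section \<open>One-dimensional Hausdorff measure is a Borel measure\<close>

lemma hausdorff1_contentI:
  assumes "A \<subseteq> (\<Union>i. C i)" "\<And>i. bounded (C i)" "\<And>i. diameter (C i) \<le> \<delta>"
  shows "hausdorff1_content \<delta> A \<le> (\<Sum>i. ennreal (diameter (C i)))"
  unfolding hausdorff1_content_def using assms by (intro INF_lower) auto

lemma hausdorff1_content_less_iff:
  "hausdorff1_content \<delta> A < x \<longleftrightarrow>
    (\<exists>C. A \<subseteq> (\<Union>i. C i) \<and> (\<forall>i. bounded (C i) \<and> diameter (C i) \<le> \<delta>) \<and>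
      (\<Sum>i. ennreal (diameter (C i))) < x)"
  unfolding hausdorff1_content_def INF_less_iff by auto

lemma hausdorff1_content_mono: "A \<subseteq> B \<Longrightarrow> hausdorff1_content \<delta> A \<le> hausdorff1_content \<delta> B"
  unfolding hausdorff1_content_def by (intro INF_superset_mono) auto

lemma hausdorff1_content_antimono: "\<delta> \<le> \<delta>' \<Longrightarrow> hausdorff1_content \<delta>' A \<le> hausdorff1_content \<delta> A"
  unfolding hausdorff1_content_def by (intro INF_superset_mono) (auto intro: order_trans)

lemma hausdorff1_content_le_outer: "0 < \<delta> \<Longrightarrow> hausdorff1_content \<delta> A \<le> hausdorff1_outer A"
  unfolding hausdorff1_outer_def by (intro SUP_upper) auto

lemma hausdorff1_outer_mono: "A \<subseteq> B \<Longrightarrow> hausdorff1_outer A \<le> hausdorff1_outer B"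
  unfolding hausdorff1_outer_def by (intro SUP_mono) (auto intro: hausdorff1_content_mono)

text \<open>
  A countable set is covered by its own points, as sets of diameter \<open>0\<close>.
\<close>

lemma hausdorff1_outer_countable:
  assumes "countable A"
  shows "hausdorff1_outer A = 0"
proof -
  have "hausdorff1_content \<delta> A \<le> 0" if "0 < \<delta>" for \<delta>
  proof (cases "A = {}")
    case True
    with that show ?thesis
      using hausdorff1_contentI[of A "\<lambda>_. {}" \<delta>] by simp
  next
    case False
    have "A = (\<Union>i. {from_nat_into A i})"
      using range_from_nat_into[OF False assms] by blast
    with that show ?thesis
      using hausdorff1_contentI[of A "\<lambda>i. {from_nat_into A i}" \<delta>] by simp
  qed
  then show ?thesis
    unfolding hausdorff1_outer_def by (auto simp: SUP_eq_iff intro!: antisym SUP_least)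
qed

lemma hausdorff1_content_countably_subadditive:
  "hausdorff1_content \<delta> (\<Union>n. A n) \<le> (\<Sum>n. hausdorff1_content \<delta> (A n))"
proof (cases "(\<Sum>n. hausdorff1_content \<delta> (A n)) = \<infinity>")
  case False
  show ?thesis
  proof (rule ennreal_le_epsilon)
    fix e :: real assume e: "0 < e"
    have fin: "hausdorff1_content \<delta> (A n) < \<infinity>" for n
      using False ennreal_suminf_lessD[of "\<lambda>n. hausdorff1_content \<delta> (A n)" \<infinity> n]
      by (simp add: less_top)
    \<comment> \<open>Near-optimal coverings, with errors that add up to \<open>e\<close>.\<close>
    have "\<exists>C. A n \<subseteq> (\<Union>i. C i) \<and> (\<forall>i. bounded (C i) \<and> diameter (C i) \<le> \<delta>) \<and>
        (\<Sum>i. ennreal (diameter (C i))) < hausdorff1_content \<delta> (A n) + ennreal (e * (1/2) ^ Suc n)" for n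
      unfolding hausdorff1_content_less_iff[symmetric]
      using ennreal_add_left_cancel_less[of "hausdorff1_content \<delta> (A n)" 0] fin[of n] e by simp
    then obtain C where C: "\<And>n. A n \<subseteq> (\<Union>i. C n i)" "\<And>n i. bounded (C n i)" "\<And>n i. diameter (C n i) \<le> \<delta>"
      "\<And>n. (\<Sum>i. ennreal (diameter (C n i))) < hausdorff1_content \<delta> (A n) + ennreal (e * (1/2) ^ Suc n)"
      by metis
    have "hausdorff1_content \<delta> (\<Union>n. A n)
        \<le> (\<Sum>i. ennreal (diameter (case_prod C (prod_decode i))))"
    proof (rule hausdorff1_contentI)
      show "(\<Union>n. A n) \<subseteq> (\<Union>i. case_prod C (prod_decode i))"
      proof safe
        fix x n assume "x \<in> A n"
        then obtain i where "x \<in> C n i" using C(1) by blast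
        then show "x \<in> (\<Union>i. case_prod C (prod_decode i))"
          by (intro UN_I[of "prod_encode (n, i)"]) auto
      qed
      show "bounded (case_prod C (prod_decode i))" for i
        by (cases "prod_decode i") (simp add: C(2))
      show "diameter (case_prod C (prod_decode i)) \<le> \<delta>" for i
        by (cases "prod_decode i") (simp add: C(3))
    qed
    also have "\<dots> = (\<Sum>n. \<Sum>i. ennreal (diameter (C n i)))"
      by (rule suminf_ennreal_2dimen[of _ "\<lambda>p. ennreal (diameter (case_prod C p))"]) simp
    also have "\<dots> \<le> (\<Sum>n. hausdorff1_content \<delta> (A n) + ennreal (e * (1/2) ^ Suc n))"
      by (intro suminf_le less_imp_le C) auto
    also have "\<dots> = (\<Sum>n. hausdorff1_content \<delta> (A n)) + (\<Sum>n. ennreal (e * (1/2) ^ Suc n))"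
      by (intro suminf_add[symmetric]) auto
    also have "(\<Sum>n. ennreal (e * (1/2) ^ Suc n)) = ennreal e"
      using e by (intro suminf_ennreal_eq) (auto intro: sums_mult[OF power_half_series, of e, simplified])
    finally show "hausdorff1_content \<delta> (\<Union>n. A n)
      \<le> (\<Sum>n. hausdorff1_content \<delta> (A n)) + ennreal e" .
  qed
qed simp

lemma hausdorff1_outer_countably_subadditive:
  "hausdorff1_outer (\<Union>n. A n) \<le> (\<Sum>n. hausdorff1_outer (A n))"
  unfolding hausdorff1_outer_def[of "\<Union>n. A n"]
proof (rule SUP_least)
  fix \<delta> :: real assume "\<delta> \<in> {0<..}"
  then have "(\<Sum>n. hausdorff1_content \<delta> (A n)) \<le> (\<Sum>n. hausdorff1_outer (A n))"
    by (intro suminf_le hausdorff1_content_le_outer) auto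
  then show "hausdorff1_content \<delta> (\<Union>n. A n) \<le> (\<Sum>n. hausdorff1_outer (A n))"
    using hausdorff1_content_countably_subadditive order_trans by blast
qed

lemma hausdorff1_outer_Un_le:
  "hausdorff1_outer (A \<union> B) \<le> hausdorff1_outer A + hausdorff1_outer B"
  using hausdorff1_outer_countably_subadditive[of "binaryset A B"]
    suminf_binaryset_eq[of hausdorff1_outer A B]
  by (simp add: UN_binaryset_eq hausdorff1_outer_countable)

text \<open>
  This is what makes Hausdorff measure a metric outer measure: a covering set of diameter
  below \<open>\<eta>\<close> cannot meet both \<open>A\<close> and \<open>B\<close>, so a fine enough covering of \<open>A \<union> B\<close> splits into one of
  \<open>A\<close> and one of \<open>B\<close>.
\<close>

lemma hausdorff1_outer_Un_separated:
  assumes "0 < \<eta>" and sep: "\<And>x y. x \<in> A \<Longrightarrow> y \<in> B \<Longrightarrow> \<eta> \<le> dist x y"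
  shows "hausdorff1_outer A + hausdorff1_outer B \<le> hausdorff1_outer (A \<union> B)"
proof -
  have small: "hausdorff1_content \<delta> A + hausdorff1_content \<delta> B \<le> hausdorff1_outer (A \<union> B)"
    if \<delta>: "0 < \<delta>" "\<delta> < \<eta>" for \<delta>
  proof -
    have "hausdorff1_content \<delta> A + hausdorff1_content \<delta> B \<le> hausdorff1_content \<delta> (A \<union> B)"
      unfolding hausdorff1_content_def[of \<delta> "A \<union> B"]
    proof (rule INF_greatest, clarify)
      fix C :: "nat \<Rightarrow> 'a set"
      assume C: "A \<union> B \<subseteq> \<Union> (range C)" "\<forall>i. bounded (C i) \<and> diameter (C i) \<le> \<delta>"
      define CA where "CA i = (if C i \<inter> A = {} then {} else C i)" for i
      define CB where "CB i = (if C i \<inter> A = {} then C i else {})" for i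
      have disj: "C i \<inter> B = {}" if meets: "C i \<inter> A \<noteq> {}" for i
      proof (rule ccontr)
        assume "C i \<inter> B \<noteq> {}"
        then obtain x y where "x \<in> A" "y \<in> B" "x \<in> C i" "y \<in> C i" using meets by blast
        then show False
          using sep[of x y] diameter_bounded_bound[of "C i" x y] C(2)[rule_format, of i] \<delta> by linarith
      qed
      have "hausdorff1_content \<delta> A \<le> (\<Sum>i. ennreal (diameter (CA i)))"
        using C \<delta> by (intro hausdorff1_contentI) (auto simp: CA_def, blast)
      moreover have "hausdorff1_content \<delta> B \<le> (\<Sum>i. ennreal (diameter (CB i)))"
        using C \<delta> disj by (intro hausdorff1_contentI) (auto simp: CB_def, blast)
      ultimately have "hausdorff1_content \<delta> A + hausdorff1_content \<delta> B
          \<le> (\<Sum>i. ennreal (diameter (CA i))) + (\<Sum>i. ennreal (diameter (CB i)))"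
        by (rule add_mono)
      also have "\<dots> = (\<Sum>i. ennreal (diameter (CA i)) + ennreal (diameter (CB i)))"
        by (intro suminf_add) auto
      also have "\<dots> = (\<Sum>i. ennreal (diameter (C i)))"
        by (intro suminf_cong) (simp add: CA_def CB_def)
      finally show "hausdorff1_content \<delta> A + hausdorff1_content \<delta> B \<le> (\<Sum>i. ennreal (diameter (C i)))" .
    qed
    then show ?thesis
      using hausdorff1_content_le_outer[OF \<delta>(1), of "A \<union> B"] by (rule order_trans)
  qed
  have "hausdorff1_outer A + hausdorff1_outer B
      = (SUP \<delta>\<in>{0<..}. hausdorff1_content \<delta> A + hausdorff1_content \<delta> B)"
    unfolding hausdorff1_outer_def
  proof (rule SUP_add_directed_ennreal[symmetric])
    show "\<exists>k\<in>{0<..}. hausdorff1_content i A + hausdorff1_content j B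
        \<le> hausdorff1_content k A + hausdorff1_content k B"
      if "i \<in> {0<..}" "j \<in> {0<..}" for i j :: real
      using that by (intro bexI[of _ "min i j"] add_mono hausdorff1_content_antimono) auto
  qed
  also have "\<dots> \<le> hausdorff1_outer (A \<union> B)"
  proof (rule SUP_least)
    fix \<delta> :: real assume \<delta>: "\<delta> \<in> {0<..}"
    have "hausdorff1_content \<delta> A + hausdorff1_content \<delta> B
      \<le> hausdorff1_content (min \<delta> (\<eta>/2)) A + hausdorff1_content (min \<delta> (\<eta>/2)) B"
      by (intro add_mono hausdorff1_content_antimono) auto
    also have "\<dots> \<le> hausdorff1_outer (A \<union> B)"
      using \<delta> \<open>0 < \<eta>\<close> by (intro small) auto
    finally show "hausdorff1_content \<delta> A + hausdorff1_content \<delta> B \<le> hausdorff1_outer (A \<union> B)" .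
  qed
  finally show ?thesis .
qed

text \<open>
  The distance to a set is 1-Lipschitz, so disjoint ranges of that distance with a gap between them
  separate the points.
\<close>

lemma hausdorff1_outer_infdist_gap:
  assumes "b < a" "A \<subseteq> {x. infdist x C \<le> b}" "B \<subseteq> {x. a \<le> infdist x C}"
  shows "hausdorff1_outer A + hausdorff1_outer B \<le> hausdorff1_outer (A \<union> B)"
proof (rule hausdorff1_outer_Un_separated)
  show "0 < a - b" using assms(1) by simp
  show "a - b \<le> dist x y" if "x \<in> A" "y \<in> B" for x y
    using that assms(2,3) infdist_triangle_abs[of x C y] by fastforce
qed

lemma sum_lessThan_double:
  fixes a :: "nat \<Rightarrow> 'a::comm_monoid_add"
  shows "(\<Sum>k<2*m. a k) = (\<Sum>k<m. a (2 * k)) + (\<Sum>k<m. a (2 * k + 1))"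
proof (induction m)
  case (Suc m)
  have "2 * Suc m = Suc (Suc (2 * m))" by simp
  then have "(\<Sum>k<2 * Suc m. a k) = (\<Sum>k<2*m. a k) + a (2*m) + a (Suc (2*m))"
    by (simp only: sum.lessThan_Suc)
  then show ?case
    unfolding Suc.IH by (simp add: add_ac)
qed simp

text \<open>
  Caratheodory's argument that closed sets are measurable for a metric outer measure. The part of
  \<open>X - C\<close> at distance more than \<open>e n\<close> from \<open>C\<close> is separated from \<open>X \<inter> C\<close>, so additivity holds for it.
  What remains of \<open>X - C\<close> is a union of thin shells \<open>R k\<close> around \<open>C\<close>. Shells whose indices differ
  by at least two are separated from each other, so the shells of even index, and likewise those of
  odd index, have total measure at most that of \<open>X\<close>. If this is finite, the measures of the shells form a
  convergent series, whose tails tend to zero.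
\<close>

lemma hausdorff1_outer_closed_caratheodory:
  fixes C X :: "'a::metric_space set"
  assumes C: "closed C"
  shows "hausdorff1_outer (X \<inter> C) + hausdorff1_outer (X - C) = hausdorff1_outer X"
proof (rule antisym)
  show "hausdorff1_outer X \<le> hausdorff1_outer (X \<inter> C) + hausdorff1_outer (X - C)"
    using hausdorff1_outer_Un_le[of "X \<inter> C" "X - C"] by (simp add: Int_Diff_Un)
next
  let ?\<mu> = "hausdorff1_outer :: 'a set \<Rightarrow> ennreal"
  show "?\<mu> (X \<inter> C) + ?\<mu> (X - C) \<le> ?\<mu> X"
  proof (cases "?\<mu> X = \<infinity> \<or> C = {}")
    case True
    then show ?thesis by (auto simp: hausdorff1_outer_countable)
  next
    case False
    then have fin: "?\<mu> X < \<infinity>" and ne: "C \<noteq> {}" by (auto simp: less_top)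
    \<comment> \<open>The shift by one keeps \<open>e\<close> decreasing from its first value on; with \<open>1 / n\<close> the
      value at \<open>n = 0\<close> would be \<open>0\<close>.\<close>
    define e :: "nat \<Rightarrow> real" where "e n = 1 / (real n + 1)" for n
    have e_less: "e m < e n" if "n < m" for m n
      using that by (auto simp: e_def field_simps)
    have e_pos: "0 < e n" for n by (simp add: e_def)
    define Y where "Y n = X \<inter> {x. e n < infdist x C}" for n
    define R where "R n = X \<inter> {x. e (n + 2) < infdist x C \<and> infdist x C \<le> e (n + 1)}" for n
    have alt: "(\<Sum>k<m. ?\<mu> (R (2 * k + i))) \<le> ?\<mu> (Y (2 * m + i))" for m i
    proof (induction m)
      case (Suc m)
      have "(\<Sum>k<Suc m. ?\<mu> (R (2 * k + i))) \<le> ?\<mu> (R (2 * m + i)) + ?\<mu> (Y (2 * m + i))"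
        using Suc by (simp add: add.commute add_left_mono)
      also have "\<dots> \<le> ?\<mu> (R (2 * m + i) \<union> Y (2 * m + i))"
        by (rule hausdorff1_outer_infdist_gap[where C=C and a="e (2*m+i)" and b="e (2*m+i+1)"])
           (auto simp: R_def Y_def intro: e_less)
      also have "\<dots> \<le> ?\<mu> (Y (2 * Suc m + i))"
        using e_less[of "2*m+i" "2*Suc m+i"]
        by (intro hausdorff1_outer_mono) (auto simp: R_def Y_def)
      finally show ?case .
    qed simp
    have bound: "(\<Sum>k<m. ?\<mu> (R k)) \<le> ?\<mu> X + ?\<mu> X" for m
    proof -
      have "(\<Sum>k<m. ?\<mu> (R k)) \<le> (\<Sum>k<2*m. ?\<mu> (R k))"
        by (rule sum_mono2) auto
      also have "\<dots> \<le> ?\<mu> (Y (2*m+0)) + ?\<mu> (Y (2*m+1))"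
        unfolding sum_lessThan_double using alt[of 0 m] alt[of 1 m] by (intro add_mono) simp_all
      also have "\<dots> \<le> ?\<mu> X + ?\<mu> X"
        by (intro add_mono hausdorff1_outer_mono) (auto simp: Y_def)
      finally show ?thesis .
    qed
    have "(\<Sum>k. ?\<mu> (R k)) \<le> ?\<mu> X + ?\<mu> X"
      unfolding suminf_eq_SUP by (intro SUP_least bound)
    also have "\<dots> < \<infinity>" using fin by simp
    finally have R_fin: "(\<Sum>k. ?\<mu> (R k)) < \<infinity>" .
    define r where "r k = enn2real (?\<mu> (R k))" for k
    have r: "?\<mu> (R k) = ennreal (r k)" for k
      unfolding r_def using ennreal_suminf_lessD[OF R_fin, of k] by simp
    have r_summable: "summable r"
      using R_fin unfolding r by (intro summable_suminf_not_top) (auto simp: less_top r_def)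
    show ?thesis
    proof (rule ennreal_le_epsilon)
      fix \<epsilon> :: real assume "0 < \<epsilon>"
      then obtain n where n: "norm (\<Sum>k. r (k + n)) < \<epsilon>"
        using suminf_exist_split[OF _ r_summable] by blast
      \<comment> \<open>A point outside \<open>C\<close> has positive distance, so it lies beyond some \<open>e m\<close>; going down in \<open>m\<close>
        finds either its shell or the region beyond \<open>e (n + 1)\<close>.\<close>
      have cover: "X - C \<subseteq> Y (n + 1) \<union> (\<Union>k. R (k + n))"
      proof
        fix x assume x: "x \<in> X - C"
        then have "0 < infdist x C"
          using C ne infdist_pos_not_in_closed by blast
        then obtain m where "e m < infdist x C"
          unfolding e_def using reals_Archimedean[of "infdist x C"]
          by (auto simp: inverse_eq_divide add.commute)
        moreover have "x \<in> Y (n + 1) \<union> (\<Union>k. R (k + n))" if "e m < infdist x C" for m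
          using that
        proof (induction m)
          case 0
          then show ?case using x e_less[of 0 "n+1"] by (auto simp: Y_def)
        next
          case (Suc m)
          show ?case
          proof (cases "e m < infdist x C")
            case False
            show ?thesis
            proof (cases "n + 1 \<le> m")
              case True
              then have "x \<in> R ((m - 1 - n) + n)"
                using Suc.prems False x by (simp add: R_def numeral_2_eq_2)
              then show ?thesis by blast
            next
              case False
              then have "e (n + 1) \<le> e (Suc m)"
                using e_less[of "Suc m" "n + 1"] by (cases "m = n") auto
              then show ?thesis using Suc.prems x by (simp add: Y_def)
            qed
          qed (rule Suc.IH)
        qed
        ultimately show "x \<in> Y (n + 1) \<union> (\<Union>k. R (k + n))" by blast
      qed
      have "?\<mu> (X - C) \<le> ?\<mu> (Y (n + 1)) + ?\<mu> (\<Union>k. R (k + n))"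
        using hausdorff1_outer_mono[OF cover] hausdorff1_outer_Un_le by (rule order_trans)
      also have "?\<mu> (\<Union>k. R (k + n)) \<le> (\<Sum>k. ?\<mu> (R (k + n)))"
        by (rule hausdorff1_outer_countably_subadditive)
      also have "\<dots> = ennreal (\<Sum>k. r (k + n))"
        unfolding r by (intro suminf_ennreal2) (auto simp: r_def intro: summable_ignore_initial_segment[OF r_summable, unfolded r_def])
      also have "\<dots> \<le> ennreal \<epsilon>"
        using n by (intro ennreal_leI) auto
      finally have "?\<mu> (X \<inter> C) + ?\<mu> (X - C) \<le> (?\<mu> (X \<inter> C) + ?\<mu> (Y (n + 1))) + ennreal \<epsilon>"
        by (simp add: add.assoc add_left_mono)
      also have "?\<mu> (X \<inter> C) + ?\<mu> (Y (n + 1)) \<le> ?\<mu> (X \<inter> C \<union> Y (n + 1))"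
        using e_pos by (intro hausdorff1_outer_infdist_gap[where C=C and b=0 and a="e (n+1)"]) (auto simp: Y_def)
      also have "\<dots> \<le> ?\<mu> X"
        by (intro hausdorff1_outer_mono) (auto simp: Y_def)
      finally show "?\<mu> (X \<inter> C) + ?\<mu> (X - C) \<le> ?\<mu> X + ennreal \<epsilon>"
        by (simp add: add_right_mono)
    qed
  qed
qed

lemma space_hausdorff1 [simp]: "space hausdorff1 = UNIV"
  and sets_hausdorff1 [measurable_cong, simp]: "sets hausdorff1 = sets borel"
  unfolding hausdorff1_def
  using sigma_algebra.sets_measure_of_eq[of UNIV "sets borel"] sets.sigma_algebra_axioms[of borel]
  by (auto simp: space_borel)

text \<open>
  By Caratheodory's theorem the outer measure is countably additive on a sigma-algebra that
  contains the closed sets, hence on the Borel sets; so the measure defined from it is not the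
  default zero measure.
\<close>

lemma emeasure_hausdorff1:
  fixes A :: "'a::metric_space set"
  assumes "A \<in> sets borel"
  shows "emeasure hausdorff1 A = hausdorff1_outer A"
proof -
  let ?\<mu> = "hausdorff1_outer :: 'a set \<Rightarrow> ennreal"
  let ?L = "lambda_system UNIV (Pow UNIV) ?\<mu>"
  interpret P: sigma_algebra "UNIV :: 'a set" "Pow UNIV" by (rule sigma_algebra_Pow)
  have "outer_measure_space (Pow UNIV) ?\<mu>"
    unfolding outer_measure_space_def
    by (auto simp: positive_def increasing_def countably_subadditive_def hausdorff1_outer_countable
      simp del: Pow_UNIV
        intro: hausdorff1_outer_mono hausdorff1_outer_countably_subadditive)
  then have L: "measure_space UNIV ?L ?\<mu>" by (rule P.caratheodory_lemma)
  then have saL: "sigma_algebra UNIV ?L" by (simp add: measure_space_def)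
  have "Collect closed \<subseteq> ?L"
    unfolding P.lambda_system_eq by (auto simp: hausdorff1_outer_closed_caratheodory simp del: Pow_UNIV)
  then have "sets borel \<subseteq> ?L"
    unfolding borel_eq_closed using sigma_algebra.sigma_sets_subset[OF saL] by simp
  then have "measure_space UNIV (sets borel) ?\<mu>"
    using L sets.sigma_algebra_axioms[of borel] measure_down by (auto simp: space_borel)
  then show ?thesis
    using assms sets.sigma_sets_eq[of "borel :: 'a measure"]
    unfolding hausdorff1_def emeasure_measure_of_conv by simp
qed

lemma countable_null_sets_hausdorff1:
  fixes A :: "'a::metric_space set"
  assumes "countable A"
  shows "A \<in> null_sets hausdorff1"
proof -
  have "A \<in> sets borel"
    by (rule sets.countable[OF _ assms]) simp
  then show ?thesis
    by (simp add: null_sets_def emeasure_hausdorff1 hausdorff1_outer_countable[OF assms])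
qed


section \<open>Hausdorff measure under Lipschitz maps and near-similarities\<close>

text \<open>
  The images of the sets of a covering cover the image, with diameters at most \<open>L\<close> times as large. Only the
  parts of the covering sets inside \<open>A\<close> are mapped, as \<open>f\<close> is controlled only there.
\<close>

lemma hausdorff1_outer_Lipschitz_image:
  fixes f :: "'a::metric_space \<Rightarrow> 'b::metric_space"
  assumes L: "0 < L" and lip: "\<And>x y. x \<in> A \<Longrightarrow> y \<in> A \<Longrightarrow> dist (f x) (f y) \<le> L * dist x y"
  shows "hausdorff1_outer (f ` A) \<le> ennreal L * hausdorff1_outer A"
  unfolding hausdorff1_outer_def[of "f ` A"]
proof (rule SUP_least)
  fix \<delta> :: real assume "\<delta> \<in> {0<..}"
  then have \<delta>: "0 < \<delta>" "0 < \<delta> / L" using L by auto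
  have "ennreal (1 / L) * hausdorff1_content \<delta> (f ` A) \<le> hausdorff1_content (\<delta> / L) A"
    unfolding hausdorff1_content_def[of "\<delta> / L"]
  proof (rule INF_greatest, clarify)
    fix C :: "nat \<Rightarrow> 'a set"
    assume C: "A \<subseteq> \<Union> (range C)" "\<forall>i. bounded (C i) \<and> diameter (C i) \<le> \<delta> / L"
    have dst: "dist u v \<le> L * diameter (C i)" if "u \<in> f ` (A \<inter> C i)" "v \<in> f ` (A \<inter> C i)" for u v i
      using that lip diameter_bounded_bound[of "C i"] C(2) L
      by (auto intro!: order_trans[OF lip] mult_left_mono)
    have bd: "bounded (f ` (A \<inter> C i))" for i
    proof (cases "A \<inter> C i = {}")
      case False
      then obtain x where "x \<in> A \<inter> C i" by blast
      with dst show ?thesis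
        by (intro bounded_subset[OF bounded_cball, of _ "f x" "L * diameter (C i)"]) auto
    qed simp
    have diam: "diameter (f ` (A \<inter> C i)) \<le> L * diameter (C i)" for i
      using dst[of _ i] C(2) L
      by (auto simp: diameter_def[of "f ` (A \<inter> C i)"] diameter_ge_0 intro!: cSUP_least)
    have "hausdorff1_content \<delta> (f ` A) \<le> (\<Sum>i. ennreal (diameter (f ` (A \<inter> C i))))"
    proof (intro hausdorff1_contentI bd)
      show "diameter (f ` (A \<inter> C i)) \<le> \<delta>" for i
        using order_trans[OF diam] C(2) L by (auto simp: field_simps)
    qed (use C(1) in blast)
    also have "\<dots> \<le> (\<Sum>i. ennreal L * ennreal (diameter (C i)))"
      using L C(2) diam by (intro suminf_le) (auto simp: ennreal_mult[symmetric] diameter_ge_0 ennreal_leI)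
    also have "\<dots> = ennreal L * (\<Sum>i. ennreal (diameter (C i)))"
      by (rule ennreal_suminf_cmult)
    finally have "ennreal (1 / L) * hausdorff1_content \<delta> (f ` A)
        \<le> ennreal (1 / L) * (ennreal L * (\<Sum>i. ennreal (diameter (C i))))"
      by (rule mult_left_mono) simp
    then show "ennreal (1 / L) * hausdorff1_content \<delta> (f ` A) \<le> (\<Sum>i. ennreal (diameter (C i)))"
      using L by (simp add: mult.assoc[symmetric] ennreal_mult[symmetric])
  qed
  also have "\<dots> \<le> hausdorff1_outer A"
    by (rule hausdorff1_content_le_outer) (rule \<delta>)
  finally have "ennreal L * (ennreal (1 / L) * hausdorff1_content \<delta> (f ` A)) \<le> ennreal L * hausdorff1_outer A"
    by (rule mult_left_mono) simp
  then show "hausdorff1_content \<delta> (f ` A) \<le> ennreal L * hausdorff1_outer A"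
    using L by (simp add: mult.assoc[symmetric] ennreal_mult[symmetric])
qed

text \<open>
  Lets the distortion of the near-similarities below tend to one.
\<close>

lemma ennreal_le_of_le_mult:
  fixes x y :: ennreal
  assumes le: "\<And>d :: real. 1 < d \<Longrightarrow> y \<le> ennreal d * x"
  shows "y \<le> x"
proof (cases x)
  case (real r)
  show ?thesis
  proof (cases "r = 0")
    case True
    then show ?thesis using le[of 2] real by simp
  next
    case False
    show ?thesis
    proof (rule ennreal_le_epsilon)
      fix e :: real assume e: "0 < e"
      have "ennreal (1 + e / r) * x = ennreal ((1 + e / r) * r)"
        using real e by (simp add: ennreal_mult)
      also have "(1 + e / r) * r = r + e"
        using False by (simp add: field_simps)
      finally show "y \<le> x + ennreal e"
        using le[of "1 + e / r"] real e False by simp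
    qed
  qed
qed simp

text \<open>
  Near a noncritical point the derivative of \<open>f(z) - f'(p) z\<close> is small, so by the mean value
  inequality \<open>f\<close> differs from a similarity of ratio \<open>m = |f'(p)|\<close> by a map with a small Lipschitz
  constant. The same ball controls \<open>|f'|\<close> up to the factor \<open>c\<close>, so that the ratio \<open>m\<close> can be
  replaced by \<open>|f'|\<close> under an integral.
\<close>

lemma holomorphic_local_near_similarity:
  assumes S: "open S" and f: "f holomorphic_on S" and p: "p \<in> S"
    and nz: "deriv f p \<noteq> 0" and c: "1 < c"
  defines "m \<equiv> norm (deriv f p)"
  obtains r where "0 < r" "ball p r \<subseteq> S"
    "\<And>z. z \<in> ball p r \<Longrightarrow> norm (deriv f z) \<le> c * m"
    "\<And>z. z \<in> ball p r \<Longrightarrow> m \<le> c * norm (deriv f z)"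
    "\<And>x y. x \<in> ball p r \<Longrightarrow> y \<in> ball p r \<Longrightarrow> dist (f x) (f y) \<le> c * m * dist x y"
    "\<And>x y. x \<in> ball p r \<Longrightarrow> y \<in> ball p r \<Longrightarrow> m * dist x y \<le> c * dist (f x) (f y)"
proof -
  have m: "0 < m" using nz by (simp add: m_def)
  \<comment> \<open>The largest error that leaves the lower bound \<open>m / c\<close>; the upper bound \<open>c m\<close> then holds because
    \<open>c + 1 / c\<close> is at least \<open>2\<close>.\<close>
  define \<epsilon> where "\<epsilon> = m * (1 - 1 / c)"
  have \<epsilon>: "0 < \<epsilon>" using m c by (simp add: \<epsilon>_def)
  have upper: "m + \<epsilon> \<le> c * m"
  proof -
    have "2 \<le> c + 1 / c" using c sum_squares_bound[of c 1] by (simp add: field_simps power2_eq_square)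
    then have "m * 2 \<le> m * (c + 1 / c)" using m by (intro mult_left_mono) auto
    then show ?thesis by (simp add: \<epsilon>_def algebra_simps)
  qed
  have lower: "c * (m - \<epsilon>) = m" using c by (simp add: \<epsilon>_def field_simps)
  have "isCont (deriv f) p"
    using holomorphic_on_imp_continuous_on[OF holomorphic_deriv[OF f S]] S p
    by (simp add: continuous_on_eq_continuous_at)
  then obtain d where d: "0 < d" "\<And>z. dist z p < d \<Longrightarrow> dist (deriv f z) (deriv f p) < \<epsilon>"
    using \<epsilon> unfolding continuous_at_eps_delta by metis
  obtain d' where d': "0 < d'" "ball p d' \<subseteq> S" using S p open_contains_ball by blast
  define r where "r = min d d'"
  have r: "0 < r" "ball p r \<subseteq> S" using d d' by (auto simp: r_def)
  have near: "norm (deriv f z - deriv f p) \<le> \<epsilon>" if "z \<in> ball p r" for z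
    using d(2)[of z] that by (simp add: r_def dist_norm dist_commute norm_minus_commute less_imp_le)
  have near': "norm (deriv f z) \<le> m + \<epsilon>" "m - \<epsilon> \<le> norm (deriv f z)" if "z \<in> ball p r" for z
    using near[OF that] norm_triangle_ineq2[of "deriv f z" "deriv f p"]
      norm_triangle_ineq3[of "deriv f z" "deriv f p"] by (auto simp: m_def)
  have lin: "norm ((f x - f y) - deriv f p * (x - y)) \<le> \<epsilon> * norm (x - y)"
    if "x \<in> ball p r" "y \<in> ball p r" for x y
  proof -
    have "norm ((f x - deriv f p * x) - (f y - deriv f p * y)) \<le> \<epsilon> * norm (x - y)"
    proof (rule field_differentiable_bound[of "ball p r" _ "\<lambda>z. deriv f z - deriv f p"])
      show "((\<lambda>z. f z - deriv f p * z) has_field_derivative deriv f z - deriv f p) (at z within ball p r)"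
        if "z \<in> ball p r" for z
        using that r(2) by (intro DERIV_diff holomorphic_derivI[OF f S] DERIV_cmult_Id) auto
    qed (use near that in auto)
    then show ?thesis by (simp add: algebra_simps)
  qed
  show thesis
  proof (rule that[OF r])
    fix z assume z: "z \<in> ball p r"
    show "norm (deriv f z) \<le> c * m" using near'(1)[OF z] upper by simp
    have "c * (m - \<epsilon>) \<le> c * norm (deriv f z)" using near'(2)[OF z] c by simp
    then show "m \<le> c * norm (deriv f z)" using lower by simp
  next
    fix x y assume xy: "x \<in> ball p r" "y \<in> ball p r"
    have mult: "norm (deriv f p * (x - y)) = m * norm (x - y)" by (simp add: norm_mult m_def)
    have "norm (f x - f y) \<le> (m + \<epsilon>) * norm (x - y)"
      using lin[OF xy] mult norm_triangle_ineq2[of "f x - f y" "deriv f p * (x - y)"]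
      by (simp add: algebra_simps)
    also have "\<dots> \<le> c * m * norm (x - y)" using upper by (simp add: mult_right_mono)
    finally show "dist (f x) (f y) \<le> c * m * dist x y" by (simp add: dist_norm)
    have "(m - \<epsilon>) * norm (x - y) \<le> norm (f x - f y)"
      using lin[OF xy] mult norm_triangle_ineq3[of "f x - f y" "deriv f p * (x - y)"]
      by (simp add: algebra_simps)
    then have "c * ((m - \<epsilon>) * norm (x - y)) \<le> c * norm (f x - f y)" using c by simp
    then show "m * dist x y \<le> c * dist (f x) (f y)"
      using lower by (simp add: dist_norm mult.assoc[symmetric])
  qed
qed

text \<open>
  The Lindelof property in the form used twice below: a local property that holds on small balls
  holds on each member of a sequence of open sets covering the space. The empty set pads the sequence if
  there are too few balls.
\<close>

lemma countable_open_cover_by_balls: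
  fixes V :: "'a::{metric_space, second_countable_topology} set"
  assumes ball: "\<And>p. p \<in> V \<Longrightarrow> \<exists>r>0. P (ball p r)" and empty: "P {}"
  obtains W :: "nat \<Rightarrow> 'a set" where "\<And>n. open (W n)" "\<And>n. P (W n)" "V \<subseteq> (\<Union>n. W n)"
proof -
  define \<F> where "\<F> = insert {} {ball p r | p r. p \<in> V \<and> 0 < r \<and> P (ball p r)}"
  obtain \<F>' where \<F>': "\<F>' \<subseteq> \<F>" "countable \<F>'" "\<Union>\<F>' = \<Union>\<F>"
    by (rule Lindelof[of \<F>]) (auto simp: \<F>_def)
  let ?W = "from_nat_into (insert {} \<F>')"
  have ran: "range ?W = insert {} \<F>'" using \<F>'(2) by (intro range_from_nat_into) auto
  then have mem: "?W n \<in> \<F>" for n using \<F>'(1) by (auto simp: \<F>_def)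
  have "V \<subseteq> \<Union>\<F>"
  proof
    fix p assume p: "p \<in> V"
    then obtain r where "0 < r" "P (ball p r)" using ball by blast
    with p show "p \<in> \<Union>\<F>" by (auto simp: \<F>_def intro!: exI[of _ "ball p r"])
  qed
  also have "\<Union>\<F> = (\<Union>n. ?W n)" using ran \<F>'(3) by simp
  finally have "V \<subseteq> (\<Union>n. ?W n)" .
  moreover have "open (?W n)" "P (?W n)" for n
    using mem[of n] empty by (auto simp: \<F>_def)
  ultimately show thesis by (rule that[rotated 2])
qed


section \<open>Change of variables for injective holomorphic functions\<close>

text \<open>
  The inverse of an injective holomorphic function is holomorphic on an open set; this is what
  makes images of Borel sets Borel.
\<close>

lemma inj_holomorphic_inverse_measurable:
  assumes D: "open D" and f: "f holomorphic_on D" and inj: "inj_on f D"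
  shows "open (f ` D)"
    and "inv_into D f \<in> borel_measurable (restrict_space borel (f ` D))"
    and "\<And>E. E \<in> sets borel \<Longrightarrow> E \<subseteq> D \<Longrightarrow> f ` E \<in> sets borel"
proof -
  obtain g where g: "g holomorphic_on f ` D" "\<And>z. z \<in> D \<Longrightarrow> g (f z) = z"
    using holomorphic_has_inverse[OF f D inj] by metis
  show op: "open (f ` D)" using open_mapping_thm3[OF f D inj] .
  have "continuous_on (f ` D) (inv_into D f)"
    using holomorphic_on_imp_continuous_on[OF g(1)]
    by (rule continuous_on_eq) (auto simp: g(2) inv_into_f_f[OF inj])
  then show meas: "inv_into D f \<in> borel_measurable (restrict_space borel (f ` D))"
    by (rule borel_measurable_continuous_on_restrict)
  fix E :: "complex set" assume E: "E \<in> sets borel" "E \<subseteq> D"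
  have "f ` E = inv_into D f -` E \<inter> space (restrict_space borel (f ` D))"
    using E(2) by (auto simp: space_restrict_space inv_into_f_f[OF inj] subset_iff image_iff)
  also have "\<dots> \<in> sets (restrict_space borel (f ` D))" by (rule measurable_sets[OF meas E(1)])
  finally show "f ` E \<in> sets borel" using op by (subst (asm) sets_restrict_space_iff) auto
qed

lemma borel_measurable_indicator_deriv:
  assumes "open D" "f holomorphic_on D"
  shows "(\<lambda>z. ennreal (norm (deriv f z)) * indicator D z) \<in> borel_measurable borel"
proof -
  have "(\<lambda>z. indicator D z *\<^sub>R deriv f z) \<in> borel_measurable borel"
    using assms by (intro borel_measurable_continuous_on_indicator holomorphic_on_imp_continuous_on
        holomorphic_deriv) auto
  then have "(\<lambda>z. ennreal (norm (indicator D z *\<^sub>R deriv f z))) \<in> borel_measurable borel"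
    by measurable
  also have "(\<lambda>z. ennreal (norm (indicator D z *\<^sub>R deriv f z))) =
      (\<lambda>z. ennreal (norm (deriv f z)) * indicator D z)"
    by (auto simp: fun_eq_iff indicator_def)
  finally show ?thesis .
qed

text \<open>
  On a piece where \<open>f\<close> distorts distances by \<open>m\<close> up to the factor \<open>c\<close>, and where the candidate
  density \<open>\<phi>\<close> is also \<open>m\<close> up to \<open>c\<close>, both \<open>H(f(E))\<close> and the integral of \<open>\<phi>\<close> over \<open>E\<close> lie between
  \<open>m H(E) / c\<close> and \<open>c m H(E)\<close>; each is thus at most \<open>c\<^sup>2\<close> times the other.
\<close>

lemma hausdorff1_image_near_similarity:
  assumes E: "E \<in> sets borel" and fE: "f ` E \<in> sets borel"
    and m: "0 < m" and c: "1 < c" and meas: "\<phi> \<in> borel_measurable borel"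
    and \<phi>: "\<And>z. z \<in> E \<Longrightarrow> \<phi> z = ennreal (d z)"
      "\<And>z. z \<in> E \<Longrightarrow> d z \<le> c * m" "\<And>z. z \<in> E \<Longrightarrow> m \<le> c * d z"
    and f: "\<And>x y. x \<in> E \<Longrightarrow> y \<in> E \<Longrightarrow> dist (f x) (f y) \<le> c * m * dist x y"
      "\<And>x y. x \<in> E \<Longrightarrow> y \<in> E \<Longrightarrow> m * dist x y \<le> c * dist (f x) (f y)"
  shows "emeasure hausdorff1 (f ` E) \<le> ennreal (c * c) * emeasure (density hausdorff1 \<phi>) E"
    and "emeasure (density hausdorff1 \<phi>) E \<le> ennreal (c * c) * emeasure hausdorff1 (f ` E)"
proof -
  let ?H = "emeasure hausdorff1"
  have [measurable]: "\<phi> \<in> borel_measurable hausdorff1" using meas by simp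
  have inj: "inj_on f E"
  proof (rule inj_onI)
    fix x y assume "x \<in> E" "y \<in> E" "f x = f y"
    then show "x = y" using f(2)[of x y] m by (simp add: mult_le_0_iff)
  qed
  have img_le: "?H (f ` E) \<le> ennreal (c * m) * ?H E"
    using E fE m c f(1) by (simp add: emeasure_hausdorff1 hausdorff1_outer_Lipschitz_image)
  have "hausdorff1_outer (inv_into E f ` f ` E) \<le> ennreal (c / m) * hausdorff1_outer (f ` E)"
  proof (rule hausdorff1_outer_Lipschitz_image)
    fix u v assume "u \<in> f ` E" "v \<in> f ` E"
    then obtain x y where "u = f x" "v = f y" "x \<in> E" "y \<in> E" by blast
    then show "dist (inv_into E f u) (inv_into E f v) \<le> c / m * dist u v"
      using f(2)[of x y] m by (simp add: inv_into_f_f[OF inj] field_simps)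
  qed (use m c in simp)
  then have le_img: "?H E \<le> ennreal (c / m) * ?H (f ` E)"
    using E fE by (simp add: emeasure_hausdorff1 inj)
  have dens: "emeasure (density hausdorff1 \<phi>) E = (\<integral>\<^sup>+z. \<phi> z * indicator E z \<partial>hausdorff1)"
    using E by (simp add: emeasure_density)
  have dens_le: "emeasure (density hausdorff1 \<phi>) E \<le> ennreal (c * m) * ?H E"
  proof -
    have "(\<integral>\<^sup>+z. \<phi> z * indicator E z \<partial>hausdorff1) \<le> (\<integral>\<^sup>+z. ennreal (c * m) * indicator E z \<partial>hausdorff1)"
      using \<phi> by (intro nn_integral_mono) (auto simp: indicator_def ennreal_leI)
    then show ?thesis using E by (simp add: dens nn_integral_cmult_indicator)
  qed
  have le_dens: "?H E \<le> ennreal (c / m) * emeasure (density hausdorff1 \<phi>) E"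
  proof -
    have "?H E = (\<integral>\<^sup>+z. indicator E z \<partial>hausdorff1)" using E by simp
    also have "\<dots> \<le> (\<integral>\<^sup>+z. ennreal (c / m) * (\<phi> z * indicator E z) \<partial>hausdorff1)"
    proof (intro nn_integral_mono)
      fix z
      show "indicator E z \<le> ennreal (c / m) * (\<phi> z * indicator E z)"
      proof (cases "z \<in> E")
        case True
        have "1 \<le> (c / m) * d z" using \<phi>(3)[OF True] m by (simp add: field_simps)
        then have "ennreal 1 \<le> ennreal ((c / m) * d z)" by (rule ennreal_leI)
        also have "\<dots> = ennreal (c / m) * ennreal (d z)"
          using \<phi>(3)[OF True] m c zero_less_mult_pos[of c "d z"] by (intro ennreal_mult) auto
        finally have "1 \<le> ennreal (c / m) * ennreal (d z)" by (simp only: ennreal_1)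
        then show ?thesis using True by (simp add: \<phi>(1))
      qed simp
    qed
    also have "\<dots> = ennreal (c / m) * emeasure (density hausdorff1 \<phi>) E"
      using E by (simp add: dens nn_integral_cmult)
    finally show ?thesis .
  qed
  have cc: "ennreal (c * m) * (ennreal (c / m) * x) = ennreal (c * c) * x" for x
    using m c by (simp add: mult.assoc[symmetric] ennreal_mult[symmetric])
  show "?H (f ` E) \<le> ennreal (c * c) * emeasure (density hausdorff1 \<phi>) E"
    using order_trans[OF img_le mult_left_mono[OF le_dens]] by (simp add: cc)
  show "emeasure (density hausdorff1 \<phi>) E \<le> ennreal (c * c) * ?H (f ` E)"
    using order_trans[OF dens_le mult_left_mono[OF le_img]] by (simp add: cc)
qed

text \<open>
  For each \<open>d > 1\<close> the set \<open>E\<close> splits into countably many Borel pieces on which \<open>f\<close> is a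
  near-similarity, and on each piece the two sides agree up to the factor \<open>d\<close>. Both sides are
  countably additive, so they agree up to \<open>d\<close> on \<open>E\<close>, for every \<open>d > 1\<close>.
\<close>

lemma hausdorff1_conformal_image:
  assumes D: "open D" and f: "f holomorphic_on D" and inj: "inj_on f D"
    and E: "E \<in> sets borel" "E \<subseteq> D"
  defines "\<phi> \<equiv> \<lambda>z. ennreal (norm (deriv f z)) * indicator D z"
  shows "emeasure hausdorff1 (f ` E) = emeasure (density hausdorff1 \<phi>) E"
proof -
  let ?\<nu> = "density hausdorff1 \<phi>"
  have meas: "\<phi> \<in> borel_measurable borel"
    unfolding \<phi>_def by (rule borel_measurable_indicator_deriv[OF D f])
  have nz: "deriv f z \<noteq> 0" if "z \<in> D" for z
    using holomorphic_injective_imp_regular[OF f D inj that] .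
  have both: "emeasure hausdorff1 (f ` E) \<le> ennreal d * emeasure ?\<nu> E \<and>
      emeasure ?\<nu> E \<le> ennreal d * emeasure hausdorff1 (f ` E)" if d: "1 < d" for d
  proof -
    \<comment> \<open>The distortion enters twice, through \<open>f\<close> and through \<open>|f'|\<close>.\<close>
    define c where "c = sqrt d"
    have c: "1 < c" "c * c = d" using d by (auto simp: c_def)
    define P where "P W \<longleftrightarrow> W \<subseteq> D \<and> (\<exists>m>0. (\<forall>z\<in>W. norm (deriv f z) \<le> c * m \<and> m \<le> c * norm (deriv f z)) \<and>
      (\<forall>x\<in>W. \<forall>y\<in>W. dist (f x) (f y) \<le> c * m * dist x y \<and> m * dist x y \<le> c * dist (f x) (f y)))" for W
    obtain W :: "nat \<Rightarrow> complex set" where W: "\<And>n. open (W n)" "\<And>n. P (W n)" "D \<subseteq> (\<Union>n. W n)"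
    proof (rule countable_open_cover_by_balls[of D P])
      fix p assume p: "p \<in> D"
      show "\<exists>r>0. P (ball p r)"
      proof (rule holomorphic_local_near_similarity[OF D f p nz[OF p] c(1)])
        fix r assume "0 < r" "ball p r \<subseteq> D"
          "\<And>z. z \<in> ball p r \<Longrightarrow> norm (deriv f z) \<le> c * norm (deriv f p)"
          "\<And>z. z \<in> ball p r \<Longrightarrow> norm (deriv f p) \<le> c * norm (deriv f z)"
          "\<And>x y. x \<in> ball p r \<Longrightarrow> y \<in> ball p r \<Longrightarrow> dist (f x) (f y) \<le> c * norm (deriv f p) * dist x y"
          "\<And>x y. x \<in> ball p r \<Longrightarrow> y \<in> ball p r \<Longrightarrow> norm (deriv f p) * dist x y \<le> c * dist (f x) (f y)"
        with nz[OF p] show ?thesis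
          unfolding P_def by (intro exI[of _ r] conjI exI[of _ "norm (deriv f p)"]) auto
      qed
    qed (auto simp: P_def intro: exI[of _ 1])
    define A where "A n = E \<inter> disjointed W n" for n
    have A_borel: "A n \<in> sets borel" for n
      using E W(1) unfolding A_def disjointed_def by (intro sets.Int sets.Diff sets.finite_UN) auto
    have A_sub: "A n \<subseteq> W n" "A n \<subseteq> E" for n
      using disjointed_subset[of W n] by (auto simp: A_def)
    have A_disj: "disjoint_family A"
      using disjoint_family_disjointed[of W] by (auto simp: disjoint_family_on_def A_def)
    have A_un: "(\<Union>n. A n) = E"
      using W(3) E(2) by (auto simp: A_def UN_disjointed_eq simp flip: Int_UN_distrib)
    have fA_borel: "f ` A n \<in> sets borel" for n
      using inj_holomorphic_inverse_measurable(3)[OF D f inj A_borel] A_sub(2) E(2) by blast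
    have fA_disj: "disjoint_family (\<lambda>n. f ` A n)"
      using A_disj inj_on_image_Int[OF inj] A_sub(2) E(2)
      unfolding disjoint_family_on_def by (metis image_empty subset_trans)
    have piece: "emeasure hausdorff1 (f ` A n) \<le> ennreal d * emeasure ?\<nu> (A n) \<and>
        emeasure ?\<nu> (A n) \<le> ennreal d * emeasure hausdorff1 (f ` A n)" for n
    proof -
      obtain m where m: "m > 0"
        "\<And>z. z \<in> W n \<Longrightarrow> norm (deriv f z) \<le> c * m \<and> m \<le> c * norm (deriv f z)"
        "\<And>x y. x \<in> W n \<Longrightarrow> y \<in> W n \<Longrightarrow> dist (f x) (f y) \<le> c * m * dist x y \<and> m * dist x y \<le> c * dist (f x) (f y)"
        using W(2)[of n] unfolding P_def by metis
      have \<phi>: "\<phi> z = ennreal (norm (deriv f z))" if "z \<in> A n" for z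
        using that A_sub(2)[of n] E(2) by (auto simp: \<phi>_def indicator_def)
      show ?thesis
        unfolding c(2)[symmetric]
        using m A_sub(1)[of n]
        by (intro conjI hausdorff1_image_near_similarity[OF A_borel fA_borel m(1) c(1) meas \<phi>]) auto
    qed
    have sum1: "emeasure hausdorff1 (f ` E) = (\<Sum>n. emeasure hausdorff1 (f ` A n))"
      using fA_borel fA_disj by (subst suminf_emeasure) (auto simp: image_UN[symmetric] A_un)
    have sum2: "emeasure ?\<nu> E = (\<Sum>n. emeasure ?\<nu> (A n))"
      using A_borel A_disj by (subst suminf_emeasure) (auto simp: A_un)
    show ?thesis
      unfolding sum1 sum2 ennreal_suminf_cmult[symmetric]
      using piece by (intro conjI suminf_le) auto
  qed
  show ?thesis
  proof (rule antisym)
    show "emeasure hausdorff1 (f ` E) \<le> emeasure ?\<nu> E"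
      by (rule ennreal_le_of_le_mult) (use both in blast)
    show "emeasure ?\<nu> E \<le> emeasure hausdorff1 (f ` E)"
      by (rule ennreal_le_of_le_mult) (use both in blast)
  qed
qed

text \<open>
  The preceding lemma says that the inverse of \<open>f\<close> carries Hausdorff measure on \<open>f(D)\<close> to the measure with
  density \<open>|f'|\<close> on \<open>D\<close>; here this is read as an equality of integrals.
\<close>

lemma nn_integral_hausdorff1_conformal:
  assumes D: "open D" and f: "f holomorphic_on D" and inj: "inj_on f D"
    and h: "h \<in> borel_measurable borel"
  shows "(\<lambda>w. h (inv_into D f w) * indicator (f ` D) w) \<in> borel_measurable borel" (is ?meas)
    and "(\<integral>\<^sup>+w. h (inv_into D f w) * indicator (f ` D) w \<partial>hausdorff1) =
      (\<integral>\<^sup>+z. h z * (ennreal (norm (deriv f z)) * indicator D z) \<partial>hausdorff1)" (is ?eq)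
proof -
  define \<phi> where "\<phi> = (\<lambda>z. ennreal (norm (deriv f z)) * indicator D z)"
  have \<phi>_meas [measurable]: "\<phi> \<in> borel_measurable hausdorff1"
    unfolding \<phi>_def using borel_measurable_indicator_deriv[OF D f] by simp
  note inv = inj_holomorphic_inverse_measurable[OF D f inj]
  let ?R = "restrict_space hausdorff1 (f ` D)"
  have inv_R [measurable]: "inv_into D f \<in> borel_measurable ?R"
    using inv(2) measurable_cong_sets[OF sets_restrict_space_cong[OF sets_hausdorff1] refl] by blast
  have fD: "f ` D \<inter> space hausdorff1 \<in> sets hausdorff1" using inv(1) by simp
  have "(\<lambda>w. h (inv_into D f w)) \<in> borel_measurable (restrict_space borel (f ` D))"
    using measurable_compose[OF inv(2) h] .
  then show ?meas
    using inv(1) by (subst (asm) borel_measurable_restrict_space_iff_ennreal) auto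
  have "distr ?R borel (inv_into D f) = density hausdorff1 \<phi>"
  proof (rule measure_eqI)
    fix A assume "A \<in> sets (distr ?R borel (inv_into D f))"
    then have A: "A \<in> sets borel" by simp
    have AD: "A \<inter> D \<in> sets borel" using sets.Int[OF A borel_open[OF D]] .
    have "inv_into D f -` A \<inter> space ?R = f ` (A \<inter> D)"
      using inv_into_f_f[OF inj] by (fastforce simp: space_restrict_space)
    then have "emeasure (distr ?R borel (inv_into D f)) A = emeasure ?R (f ` (A \<inter> D))"
      using A by (simp add: emeasure_distr)
    also have "\<dots> = emeasure hausdorff1 (f ` (A \<inter> D))"
      using fD by (intro emeasure_restrict_space) auto
    also have "\<dots> = emeasure (density hausdorff1 \<phi>) (A \<inter> D)"
      unfolding \<phi>_def using AD by (intro hausdorff1_conformal_image[OF D f inj]) auto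
    also have "\<dots> = emeasure (density hausdorff1 \<phi>) A"
    proof -
      have "\<phi> z * indicator (A \<inter> D) z = \<phi> z * indicator A z" for z
        by (simp add: \<phi>_def indicator_def)
      then show ?thesis using A AD by (simp add: emeasure_density)
    qed
    finally show "emeasure (distr ?R borel (inv_into D f)) A = emeasure (density hausdorff1 \<phi>) A" .
  qed simp
  then have "(\<integral>\<^sup>+z. h z \<partial>density hausdorff1 \<phi>) = (\<integral>\<^sup>+w. h (inv_into D f w) \<partial>?R)"
    using h by (metis nn_integral_distr[OF inv_R] measurable_distr_eq1)
  then show ?eq
    using h fD nn_integral_density[OF \<phi>_meas, of h]
    by (simp add: nn_integral_restrict_space \<phi>_def mult.commute)
qed


section \<open>The area formula for holomorphic functions\<close>

text \<open>
  Local injectivity splits \<open>V\<close> into countably many disjoint Borel pieces \<open>A n\<close>, each inside an open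
  set \<open>W n\<close> on which \<open>f\<close> is injective. A fibre of \<open>f\<close> meets each piece at most once, so the sum
  over the fibre is the sum over \<open>n\<close> of the values at the inverse branches of \<open>f\<close> on the \<open>W n\<close>.
  This identity also shows that the fibre sum is measurable, and the integral formula
  follows by integrating it term by term.
\<close>

lemma area_formula_hausdorff1:
  assumes V: "open V" and f: "f holomorphic_on V" and nz: "\<And>z. z \<in> V \<Longrightarrow> deriv f z \<noteq> 0"
    and h: "h \<in> borel_measurable borel"
  shows "(\<lambda>w. \<Sum>\<^sub>\<infinity>z\<in>f -` {w} \<inter> V. h z) \<in> borel_measurable borel" (is ?meas)
    and "(\<integral>\<^sup>+w. (\<Sum>\<^sub>\<infinity>z\<in>f -` {w} \<inter> V. h z) \<partial>hausdorff1) =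
      (\<integral>\<^sup>+z. h z * (ennreal (norm (deriv f z)) * indicator V z) \<partial>hausdorff1)" (is ?eq)
proof -
  obtain W :: "nat \<Rightarrow> complex set"
    where W: "\<And>n. open (W n)" "\<And>n. W n \<subseteq> V \<and> inj_on f (W n)" "V \<subseteq> (\<Union>n. W n)"
  proof (rule countable_open_cover_by_balls[of V "\<lambda>W. W \<subseteq> V \<and> inj_on f W"])
    fix p assume p: "p \<in> V"
    obtain r where "0 < r" "ball p r \<subseteq> V" "inj_on f (ball p r)"
      using has_complex_derivative_locally_injective[OF f p V nz[OF p]] by blast
    then show "\<exists>r>0. ball p r \<subseteq> V \<and> inj_on f (ball p r)" by blast
  qed auto
  have fW: "f holomorphic_on W n" and inj: "inj_on f (W n)" for n
    using W(2)[of n] f holomorphic_on_subset by auto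
  define A where "A = disjointed W"
  have A_sub: "A n \<subseteq> W n" for n by (simp add: A_def disjointed_subset)
  have A_disj: "disjoint_family A" by (simp add: A_def disjoint_family_disjointed)
  have A_un: "(\<Union>n. A n) = V" using W(2,3) by (auto simp: A_def UN_disjointed_eq)
  have A_borel [measurable]: "A n \<in> sets borel" for n
    using W(1) unfolding A_def disjointed_def by (intro sets.Diff sets.finite_UN) auto
  define hn where "hn n z = h z * indicator (A n) z" for n z
  have hn: "hn n \<in> borel_measurable borel" for n
    unfolding hn_def using h by measurable
  define k where "k n w = hn n (inv_into (W n) f w) * indicator (f ` W n) w" for n w
  have k_meas: "k n \<in> borel_measurable borel" for n
    unfolding k_def by (rule nn_integral_hausdorff1_conformal(1)[OF W(1) fW inj hn])
  have k_int: "(\<integral>\<^sup>+w. k n w \<partial>hausdorff1)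
      = (\<integral>\<^sup>+z. hn n z * (ennreal (norm (deriv f z)) * indicator (W n) z) \<partial>hausdorff1)" for n
    unfolding k_def by (rule nn_integral_hausdorff1_conformal(2)[OF W(1) fW inj hn])
  have fibre: "(\<Sum>\<^sub>\<infinity>z\<in>f -` {w} \<inter> V. h z) = (\<Sum>n. k n w)" for w
  proof -
    let ?z = "\<lambda>n. inv_into (W n) f w"
    define T where "T = {n. w \<in> f ` A n}"
    have z: "?z n \<in> A n" "f (?z n) = w" if "n \<in> T" for n
      using that A_sub[of n] by (auto simp: T_def inv_into_f_f[OF inj] subset_iff)
    have z_eq: "?z n = z" if "z \<in> A n" "f z = w" for n z
      using that A_sub[of n] inv_into_f_f[OF inj, of z n] by blast
    have "bij_betw ?z T (f -` {w} \<inter> V)"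
    proof (rule bij_betwI')
      fix m n assume mn: "m \<in> T" "n \<in> T"
      show "(?z m = ?z n) = (m = n)"
        using z[OF mn(1)] z[OF mn(2)] A_disj unfolding disjoint_family_on_def
        by (metis UNIV_I disjoint_iff)
    next
      fix n assume "n \<in> T"
      then show "?z n \<in> f -` {w} \<inter> V" using z A_un by blast
    next
      fix z assume "z \<in> f -` {w} \<inter> V"
      then obtain n where "z \<in> A n" "f z = w" using A_un by blast
      then show "\<exists>n\<in>T. z = ?z n" using z_eq by (intro bexI[of _ n]) (auto simp: T_def)
    qed
    then have "(\<Sum>\<^sub>\<infinity>z\<in>f -` {w} \<inter> V. h z) = (\<Sum>\<^sub>\<infinity>n\<in>T. h (?z n))"
      by (rule infsum_reindex_bij_betw[symmetric])
    also have "\<dots> = (\<Sum>\<^sub>\<infinity>n. k n w)"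
    proof (rule infsum_cong_neutral)
      fix n assume "n \<in> UNIV - T"
      then have "?z n \<notin> A n" if "w \<in> f ` W n"
        using f_inv_into_f[OF that] by (force simp: T_def)
      then show "k n w = 0" by (auto simp: k_def hn_def indicator_def)
    next
      fix n assume "n \<in> T \<inter> UNIV"
      then have "n \<in> T" "w \<in> f ` W n" using A_sub[of n] by (auto simp: T_def)
      then show "h (?z n) = k n w"
        using z[of n] by (simp add: k_def hn_def)
    qed auto
    also have "\<dots> = (\<Sum>n. k n w)"
    proof -
      have "(\<lambda>n. k n w) summable_on UNIV" by (rule nonneg_summable_on_complete) simp
      then show ?thesis by (intro sums_unique has_sum_imp_sums has_sum_infsum)
    qed
    finally show ?thesis .
  qed
  show ?meas
    unfolding fibre using k_meas by measurable
  have "(\<integral>\<^sup>+w. (\<Sum>\<^sub>\<infinity>z\<in>f -` {w} \<inter> V. h z) \<partial>hausdorff1) = (\<Sum>n. \<integral>\<^sup>+w. k n w \<partial>hausdorff1)"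
    unfolding fibre using k_meas by (intro nn_integral_suminf) simp
  also have "\<dots> = (\<integral>\<^sup>+z. (\<Sum>n. hn n z * (ennreal (norm (deriv f z)) * indicator (W n) z)) \<partial>hausdorff1)"
    unfolding k_int using hn borel_measurable_indicator_deriv[OF W(1) fW]
    by (intro nn_integral_suminf[symmetric]) simp
  also have "\<dots> = (\<integral>\<^sup>+z. h z * (ennreal (norm (deriv f z)) * indicator V z) \<partial>hausdorff1)"
  proof (rule nn_integral_cong)
    fix z
    have "hn n z * (ennreal (norm (deriv f z)) * indicator (W n) z)
        = h z * ennreal (norm (deriv f z)) * indicator (A n) z" for n
      using A_sub[of n] by (auto simp: hn_def indicator_def)
    then show "(\<Sum>n. hn n z * (ennreal (norm (deriv f z)) * indicator (W n) z)) =
        h z * (ennreal (norm (deriv f z)) * indicator V z)"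
      by (simp add: suminf_indicator[OF A_disj] A_un mult.assoc)
  qed
  finally show ?eq .
qed


section \<open>Measurability of curves, critical points, and completions\<close>

text \<open>
  Continuous images of compact sets are compact, and an interval is the union of its
  compact subintervals with rational end points and of those of its own end points that belong to
  it.
\<close>

lemma borel_image_interval:
  fixes h :: "real \<Rightarrow> 'b::metric_space"
  assumes I: "is_interval I" and h: "continuous_on I h"
  shows "h ` I \<in> sets borel"
proof -
  define Q where "Q = {(p, q). p \<in> I \<inter> \<rat> \<and> q \<in> I \<inter> \<rat>}"
  define E where "E = {x\<in>I. \<forall>y\<in>I. x \<le> y} \<union> {x\<in>I. \<forall>y\<in>I. y \<le> x}"
  have Q: "countable Q"
    by (rule countable_subset[of _ "\<rat> \<times> \<rat>"]) (auto simp: Q_def countable_rat)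
  have sub: "{p..q} \<subseteq> I" if "(p, q) \<in> Q" for p q
    using that I by (auto simp: Q_def is_interval_1)
  have "E \<subseteq> {Inf I, Sup I}"
    unfolding E_def using cInf_eq_minimum[of _ I] cSup_eq_maximum[of _ I] by fastforce
  then have E: "countable E" by (rule countable_subset) simp
  have "I = (\<Union>(p, q)\<in>Q. {p..q}) \<union> E"
  proof
    show "I \<subseteq> (\<Union>(p, q)\<in>Q. {p..q}) \<union> E"
    proof
      fix x assume x: "x \<in> I"
      show "x \<in> (\<Union>(p, q)\<in>Q. {p..q}) \<union> E"
      proof (cases "x \<in> E")
        case False
        then obtain y z where yz: "y \<in> I" "y < x" "z \<in> I" "x < z"
          using x by (auto simp: E_def not_le)
        then obtain p q where pq: "p \<in> \<rat>" "y < p" "p < x" "q \<in> \<rat>" "x < q" "q < z"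
          using Rats_dense_in_real by metis
        then have "p \<in> I" "q \<in> I"
          using yz I unfolding is_interval_1 by (meson less_imp_le less_trans)+
        with pq have "(p, q) \<in> Q" "x \<in> {p..q}" by (auto simp: Q_def)
        then show ?thesis by blast
      qed simp
    qed
    show "(\<Union>(p, q)\<in>Q. {p..q}) \<union> E \<subseteq> I" using sub by (auto simp: E_def)
  qed
  then have "h ` I = (\<Union>(p, q)\<in>Q. h ` {p..q}) \<union> h ` E" by (auto simp: image_iff)
  moreover have "h ` {p..q} \<in> sets borel" if "(p, q) \<in> Q" for p q
    using continuous_on_subset[OF h sub[OF that]]
    by (intro borel_closed compact_imp_closed compact_continuous_image) auto
  moreover have "h ` E \<in> sets borel"
    using E by (intro sets.countable[of "h ` E"]) auto
  ultimately show ?thesis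
    using Q by (auto intro!: sets.Un sets.countable_UN')
qed

lemma smooth_curve_borel:
  fixes f :: "complex \<Rightarrow> complex"
  assumes "smooth_curve \<gamma>"
  shows "\<gamma> \<in> sets borel"
    and "continuous_on \<gamma> f \<Longrightarrow> f ` \<gamma> \<in> sets borel"
proof -
  obtain g I where g: "is_interval I" "g C1_differentiable_on I" "\<gamma> = g ` I"
    using assms unfolding smooth_curve_def by blast
  have cont: "continuous_on I g"
    using g(2) by (rule C1_differentiable_imp_continuous_on)
  show "\<gamma> \<in> sets borel"
    using borel_image_interval[OF g(1) cont] g(3) by simp
  show "f ` \<gamma> \<in> sets borel" if "continuous_on \<gamma> f"
    using borel_image_interval[OF g(1) continuous_on_compose[OF cont, of f]] that g(3)
    by (simp add: image_image)
qed

text \<open>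
  The derivative is holomorphic, so its zeros are countable unless it is constant; a constant
  derivative is nonzero, as \<open>f\<close> is not constant.
\<close>

lemma countable_critical_points:
  assumes U: "open U" "connected U" and f: "f holomorphic_on U" and nonconst: "\<not> f constant_on U"
  shows "countable {z\<in>U. deriv f z = 0}"
proof (cases "deriv f constant_on U")
  case True
  then obtain c where c: "\<And>z. z \<in> U \<Longrightarrow> deriv f z = c" by (auto simp: constant_on_def)
  have "c \<noteq> 0"
  proof
    assume "c = 0"
    then have "f constant_on U"
      using c holomorphic_derivI[OF f U(1)]
      by (intro has_field_derivative_0_imp_constant_on[OF _ U(2,1)]) metis
    with nonconst show False by contradiction
  qed
  then show ?thesis using c by (simp cong: conj_cong)
next
  case False
  obtain C :: "nat \<Rightarrow> complex set" where C: "\<And>n. compact (C n)" "U = (\<Union>n. C n)"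
    using open_Union_compact_subsets[OF U(1)] by metis
  then have "fsigma U" by (subst fsigma_Union_compact) (rule exI[of _ C], auto)
  then show ?thesis
    using holomorphic_countable_zeros[OF holomorphic_deriv[OF f U(1)] U] False by blast
qed

text \<open>
  Needed because \<open>f\<close> is arbitrary outside \<open>U\<close>: the composition with the process
  agrees with a measurable function only almost surely.
\<close>

lemma measurable_completion_cong_AE:
  assumes X: "X \<in> measurable (completion M) N" and eq: "AE \<omega> in M. X \<omega> = Y \<omega>"
    and Y: "Y \<in> space M \<rightarrow> space N"
  shows "Y \<in> measurable (completion M) N"
proof (rule measurableI)
  fix A assume A: "A \<in> sets N"
  from eq obtain Z where Z: "Z \<in> null_sets M" "{\<omega>\<in>space M. X \<omega> \<noteq> Y \<omega>} \<subseteq> Z"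
    unfolding eventually_ae_filter by auto
  have split: "Y -` A \<inter> space (completion M) =
      (X -` A \<inter> space (completion M) - Z) \<union> (Y -` A \<inter> space M \<inter> Z)"
    using Z(2) by auto
  have "Y -` A \<inter> space M \<inter> Z \<in> sets (completion M)"
    by (rule null_sets_completion[OF Z(1)]) auto
  moreover have "X -` A \<inter> space (completion M) - Z \<in> sets (completion M)"
    using measurable_sets[OF X A] Z(1) by (intro sets.Diff) auto
  ultimately show "Y -` A \<inter> space (completion M) \<in> sets (completion M)"
    by (subst split) (rule sets.Un)
qed (use Y in auto)


section \<open>Densities with respect to arclength\<close>

text \<open>
  Both densities have the same integrals over all sets, in particular over the set where one
  exceeds the other; as these integrals are finite, their difference shows that this set is null.
\<close>

lemma arclength_density_unique:
  assumes "finite_measure M"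
    and \<rho>: "has_arclength_density M X C \<rho>" "has_arclength_density M X C \<rho>'"
  shows "AE z in arclength_on C. \<rho> z = \<rho>' z"
proof -
  interpret finite_measure M by fact
  let ?N = "arclength_on C"
  have meas: "\<rho> \<in> borel_measurable ?N" "\<rho>' \<in> borel_measurable ?N"
    and dens: "\<And>A. A \<in> sets ?N \<Longrightarrow>
      emeasure (completion M) (X -` A \<inter> space M) = (\<integral>\<^sup>+z\<in>A. \<rho> z \<partial>?N) \<and>
      emeasure (completion M) (X -` A \<inter> space M) = (\<integral>\<^sup>+z\<in>A. \<rho>' z \<partial>?N)"
    using \<rho> by (auto simp: has_arclength_density_def)
  have "density ?N \<rho> = density ?N \<rho>'"
  proof (rule measure_eqI)
    fix A assume "A \<in> sets (density ?N \<rho>)"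
    then have A: "A \<in> sets ?N" by simp
    have "(\<integral>\<^sup>+z\<in>A. \<rho> z \<partial>?N) = (\<integral>\<^sup>+z\<in>A. \<rho>' z \<partial>?N)"
      using dens[OF A] by metis
    then show "emeasure (density ?N \<rho>) A = emeasure (density ?N \<rho>') A"
      using A meas by (simp add: emeasure_density)
  qed simp
  moreover have "integral\<^sup>N ?N \<rho> \<noteq> \<infinity>"
  proof -
    have "integral\<^sup>N ?N \<rho> = (\<integral>\<^sup>+z\<in>space ?N. \<rho> z \<partial>?N)"
      by (intro nn_integral_cong) simp
    also have "\<dots> = emeasure (completion M) (X -` space ?N \<inter> space M)"
      using dens[of "space ?N"] by simp
    also have "\<dots> \<le> emeasure (completion M) (space (completion M))"
      by (rule emeasure_space)
    also have "\<dots> = emeasure M (space M)" by simp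
    finally show ?thesis using emeasure_finite[of "space M"] by (auto simp: top_unique)
  qed
  ultimately show ?thesis
    using finite_density_unique[of \<rho> ?N \<rho>'] meas by simp
qed

text \<open>
  For Borel sets \<open>C\<close> the restricted measure can be traded for indicator functions, so that all
  densities and integrals live on the whole plane, where the area formula is stated.
\<close>

lemma has_arclength_density_iff:
  assumes C: "C \<in> sets borel"
  shows "has_arclength_density M X C \<rho> \<longleftrightarrow>
    X \<in> borel_measurable (completion M) \<and>
    (\<lambda>z. \<rho> z * indicator C z) \<in> borel_measurable borel \<and>
    (\<forall>A\<in>sets borel. A \<subseteq> C \<longrightarrow>
      emeasure (completion M) (X -` A \<inter> space M) = (\<integral>\<^sup>+z. \<rho> z * indicator A z \<partial>hausdorff1))"
proof -
  have C': "C \<inter> space hausdorff1 \<in> sets hausdorff1" using C by simp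
  have sets: "A \<in> sets (arclength_on C) \<longleftrightarrow> A \<subseteq> C \<and> A \<in> sets borel" for A
    unfolding arclength_on_def sets_restrict_space_iff[OF C'] by simp
  have meas: "\<rho> \<in> borel_measurable (arclength_on C) \<longleftrightarrow>
      (\<lambda>z. \<rho> z * indicator C z) \<in> borel_measurable borel"
    unfolding arclength_on_def borel_measurable_restrict_space_iff_ennreal[OF C']
    by (simp cong: measurable_cong_sets)
  have int: "(\<integral>\<^sup>+z\<in>A. \<rho> z \<partial>arclength_on C) = (\<integral>\<^sup>+z. \<rho> z * indicator A z \<partial>hausdorff1)"
    if "A \<subseteq> C" for A
    unfolding arclength_on_def nn_integral_restrict_space[OF C'] using that
    by (intro nn_integral_cong) (auto simp: indicator_def)
  show ?thesis
    unfolding has_arclength_density_def meas Ball_def sets using int by auto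
qed

text \<open>
  The area formula is applied on the complement \<open>V\<close> of the critical points, once for each event \<open>A\<close>, to the
  function \<open>h A\<close>, which is \<open>\<rho> / |f'|\<close> on the part of \<open>\<gamma>\<close> mapped into \<open>A\<close>. Its fibre sums are
  \<open>\<rho>'\<close> on \<open>A\<close> and zero off \<open>A\<close>, except possibly at the countably many critical values.
\<close>

lemma has_arclength_density_holomorphic_image:
  assumes U: "open U" "connected U" and f: "f holomorphic_on U" and nonconst: "\<not> f constant_on U"
    and \<gamma>: "\<gamma> \<in> sets borel" "\<gamma> \<subseteq> U" and f\<gamma>: "f ` \<gamma> \<in> sets borel"
    and X\<gamma>: "AE \<omega> in M. X \<omega> \<in> \<gamma>"
    and X: "has_arclength_density M X \<gamma> \<rho>"
  shows "has_arclength_density M (\<lambda>\<omega>. f (X \<omega>)) (f ` \<gamma>)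
    (\<lambda>w. \<Sum>\<^sub>\<infinity>z\<in>f -` {w} \<inter> \<gamma>. \<rho> z / ennreal (norm (deriv f z)))"
proof -
  define \<rho>' where "\<rho>' = (\<lambda>w. \<Sum>\<^sub>\<infinity>z\<in>f -` {w} \<inter> \<gamma>. \<rho> z / ennreal (norm (deriv f z)))"
  define crit where "crit = {z\<in>U. deriv f z = 0}"
  define V where "V = U \<inter> deriv f -` (- {0})"
  have crit: "countable crit"
    unfolding crit_def by (rule countable_critical_points[OF U f nonconst])
  have V: "open V" unfolding V_def
    by (intro continuous_open_preimage holomorphic_on_imp_continuous_on holomorphic_deriv f U) auto
  have fV: "f holomorphic_on V" using f by (rule holomorphic_on_subset) (auto simp: V_def)
  \<comment> \<open>A Borel function that agrees with \<open>f\<close> on \<open>U\<close>.\<close>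
  define F where "F = (\<lambda>z. indicator U z *\<^sub>R f z)"
  have F [measurable]: "F \<in> borel_measurable borel"
    unfolding F_def using U f
    by (intro borel_measurable_continuous_on_indicator holomorphic_on_imp_continuous_on) auto
  have F_eq: "F z = f z" if "z \<in> U" for z using that by (simp add: F_def)
  have Xm: "X \<in> borel_measurable (completion M)"
    and r [measurable]: "(\<lambda>z. \<rho> z * indicator \<gamma> z) \<in> borel_measurable borel"
    and Xd: "\<And>A. A \<in> sets borel \<Longrightarrow> A \<subseteq> \<gamma> \<Longrightarrow>
      emeasure (completion M) (X -` A \<inter> space M) = (\<integral>\<^sup>+z. \<rho> z * indicator A z \<partial>hausdorff1)"
    using X unfolding has_arclength_density_iff[OF \<gamma>(1)] by blast+
  define h where "h A z = (\<rho> z * indicator \<gamma> z) * indicator A (F z) /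
    (ennreal (norm (deriv f z)) * indicator U z)" for A z
  have h: "h A \<in> borel_measurable borel" if [measurable]: "A \<in> sets borel" for A
    unfolding h_def using borel_measurable_indicator_deriv[OF U(1) f] by measurable
  note area = area_formula_hausdorff1[OF V fV _ h]
  have fibre: "(\<Sum>\<^sub>\<infinity>z\<in>f -` {w} \<inter> V. h A z) = \<rho>' w * indicator A w" if w: "w \<notin> f ` crit" for A w
  proof (cases "w \<in> A")
    case True
    have "(\<Sum>\<^sub>\<infinity>z\<in>f -` {w} \<inter> V. h A z) = \<rho>' w"
      unfolding \<rho>'_def
    proof (rule infsum_cong_neutral)
      fix z assume "z \<in> (f -` {w} \<inter> \<gamma>) - (f -` {w} \<inter> V)"
      then have "z \<in> crit" "f z = w" using \<gamma>(2) by (auto simp: V_def crit_def)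
      with w show "\<rho> z / ennreal (norm (deriv f z)) = 0" by blast
    next
      fix z assume "z \<in> (f -` {w} \<inter> V) - (f -` {w} \<inter> \<gamma>)"
      then show "h A z = 0" by (simp add: h_def)
    next
      fix z assume "z \<in> (f -` {w} \<inter> V) \<inter> (f -` {w} \<inter> \<gamma>)"
      then show "h A z = \<rho> z / ennreal (norm (deriv f z))"
        using True \<gamma>(2) by (auto simp: h_def F_eq subset_iff)
    qed
    with True show ?thesis by simp
  next
    case False
    have "(\<Sum>\<^sub>\<infinity>z\<in>f -` {w} \<inter> V. h A z) = 0"
      using False by (intro infsum_0) (auto simp: h_def V_def F_eq)
    with False show ?thesis by simp
  qed
  have \<rho>'_meas: "\<rho>' \<in> borel_measurable borel"
  proof (rule measurable_discrete_difference)
    show "(\<lambda>w. \<Sum>\<^sub>\<infinity>z\<in>f -` {w} \<inter> V. h UNIV z) \<in> borel_measurable borel"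
      by (rule area(1)) (auto simp: V_def)
    show "countable (f ` crit)" using crit by simp
    show "(\<Sum>\<^sub>\<infinity>z\<in>f -` {w} \<inter> V. h UNIV z) = \<rho>' w" if "w \<notin> f ` crit" for w
      using fibre[OF that, of UNIV] by simp
  qed auto
  have int: "(\<integral>\<^sup>+w. \<rho>' w * indicator A w \<partial>hausdorff1) =
      (\<integral>\<^sup>+z. \<rho> z * indicator (F -` A \<inter> \<gamma>) z \<partial>hausdorff1)" if A: "A \<in> sets borel" for A
  proof -
    have "(\<integral>\<^sup>+w. \<rho>' w * indicator A w \<partial>hausdorff1)
        = (\<integral>\<^sup>+w. (\<Sum>\<^sub>\<infinity>z\<in>f -` {w} \<inter> V. h A z) \<partial>hausdorff1)"
    proof (rule nn_integral_cong_AE)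
      have "AE w in hausdorff1. w \<notin> f ` crit"
        using crit by (intro AE_not_in countable_null_sets_hausdorff1) simp
      then show "AE w in hausdorff1. \<rho>' w * indicator A w = (\<Sum>\<^sub>\<infinity>z\<in>f -` {w} \<inter> V. h A z)"
        by (rule AE_mp) (auto simp: fibre)
    qed
    also have "\<dots> = (\<integral>\<^sup>+z. h A z * (ennreal (norm (deriv f z)) * indicator V z) \<partial>hausdorff1)"
      using A by (intro area(2)) (auto simp: V_def)
    also have "\<dots> = (\<integral>\<^sup>+z. \<rho> z * indicator (F -` A \<inter> \<gamma>) z \<partial>hausdorff1)"
    proof (rule nn_integral_cong_AE)
      have "AE z in hausdorff1. z \<notin> crit"
        using crit by (intro AE_not_in countable_null_sets_hausdorff1)
      moreover have "h A z * (ennreal (norm (deriv f z)) * indicator V z) =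
          \<rho> z * indicator (F -` A \<inter> \<gamma>) z" if "z \<notin> crit" for z
      proof (cases "z \<in> \<gamma>")
        case True
        then have z: "z \<in> U" "z \<in> V" "deriv f z \<noteq> 0"
          using that \<gamma>(2) by (auto simp: V_def crit_def)
        have "x / ennreal (norm (deriv f z)) * ennreal (norm (deriv f z)) = x" for x
          using z(3) by (subst mult.commute)
            (simp add: ennreal_times_divide ennreal_mult_divide_eq mult.commute[of _ x])
        with True z show ?thesis by (simp add: h_def indicator_def)
      qed (simp add: h_def)
      ultimately show "AE z in hausdorff1. h A z * (ennreal (norm (deriv f z)) * indicator V z) =
          \<rho> z * indicator (F -` A \<inter> \<gamma>) z"
        by (rule eventually_mono)
    qed
    finally show ?thesis .
  qed
  have FX: "(\<lambda>\<omega>. F (X \<omega>)) \<in> borel_measurable (completion M)"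
    using Xm F by (rule measurable_compose)
  have fX: "(\<lambda>\<omega>. f (X \<omega>)) \<in> borel_measurable (completion M)"
    by (rule measurable_completion_cong_AE[OF FX])
       (use X\<gamma> \<gamma>(2) in \<open>auto simp: F_eq subset_iff elim!: eventually_mono\<close>)
  have "emeasure (completion M) ((\<lambda>\<omega>. f (X \<omega>)) -` A \<inter> space M) = (\<integral>\<^sup>+w. \<rho>' w * indicator A w \<partial>hausdorff1)"
    if A: "A \<in> sets borel" for A
  proof -
    have A': "F -` A \<inter> \<gamma> \<in> sets borel"
      using measurable_sets[OF F A] \<gamma>(1) by (intro sets.Int) auto
    have "emeasure (completion M) ((\<lambda>\<omega>. f (X \<omega>)) -` A \<inter> space M)
        = emeasure (completion M) (X -` (F -` A \<inter> \<gamma>) \<inter> space M)"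
    proof (rule emeasure_eq_AE)
      have "AE \<omega> in completion M. X \<omega> \<in> \<gamma>" using X\<gamma> by (rule AE_completion)
      then show "AE \<omega> in completion M. (\<omega> \<in> (\<lambda>\<omega>. f (X \<omega>)) -` A \<inter> space M) \<longleftrightarrow>
          (\<omega> \<in> X -` (F -` A \<inter> \<gamma>) \<inter> space M)"
        using \<gamma>(2) by (auto simp: F_eq subset_iff elim!: eventually_mono)
    qed (use measurable_sets[OF fX A] measurable_sets[OF Xm A'] in simp_all)
    also have "\<dots> = (\<integral>\<^sup>+z. \<rho> z * indicator (F -` A \<inter> \<gamma>) z \<partial>hausdorff1)"
      using A' by (rule Xd) simp
    finally show ?thesis using int[OF A] by simp
  qed
  then show ?thesis
    unfolding has_arclength_density_iff[OF f\<gamma>] \<rho>'_def[symmetric]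
    using fX \<rho>'_meas f\<gamma> by simp
qed

theorem theorem2:
  fixes U \<gamma> :: "complex set" and f :: "complex \<Rightarrow> complex" and a :: complex
    and M :: "'w measure" and F :: "ennreal \<Rightarrow> 'w measure"
    and B :: "real \<Rightarrow> 'w \<Rightarrow> complex" and \<tau> :: "'w \<Rightarrow> ennreal"
    and \<rho> :: "complex \<Rightarrow> ennreal"
  assumes "open U" and "connected U"
    and "f analytic_on U" and "\<not> f constant_on U"
    and "a \<in> U"
    and "planar_brownian_motion M F a B"
    and "stopping_time F \<tau>"
    and "AE \<omega> in M. \<tau> \<omega> < \<infinity>"
    and "AE \<omega> in M. \<forall>t. 0 \<le> t \<and> ennreal t \<le> \<tau> \<omega> \<longrightarrow> B t \<omega> \<in> U"
    and "smooth_curve \<gamma>" and "\<gamma> \<subseteq> U"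
    and "AE \<omega> in M. stopped_at B \<tau> \<omega> \<in> \<gamma>"
    and "has_arclength_density M (stopped_at B \<tau>) \<gamma> \<rho>"
  shows "(AE \<omega> in M. f (stopped_at B \<tau> \<omega>) \<in> f ` \<gamma>) \<and>
    (\<exists>\<rho>'. has_arclength_density M (\<lambda>\<omega>. f (stopped_at B \<tau> \<omega>)) (f ` \<gamma>) \<rho>') \<and>
    (\<forall>\<rho>'. has_arclength_density M (\<lambda>\<omega>. f (stopped_at B \<tau> \<omega>)) (f ` \<gamma>) \<rho>' \<longrightarrow>
      (AE w in arclength_on (f ` \<gamma>).
        \<rho>' w = (\<Sum>\<^sub>\<infinity>z\<in>f -` {w} \<inter> \<gamma>. \<rho> z / ennreal (norm (deriv f z)))))"
proof -
  have f: "f holomorphic_on U" using assms(3) by (rule analytic_imp_holomorphic)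
  then have "continuous_on \<gamma> f"
    using assms(11) holomorphic_on_imp_continuous_on continuous_on_subset by blast
  then have dens: "has_arclength_density M (\<lambda>\<omega>. f (stopped_at B \<tau> \<omega>)) (f ` \<gamma>)
      (\<lambda>w. \<Sum>\<^sub>\<infinity>z\<in>f -` {w} \<inter> \<gamma>. \<rho> z / ennreal (norm (deriv f z)))"
    using smooth_curve_borel[OF assms(10)] assms(11)
    by (intro has_arclength_density_holomorphic_image[OF assms(1,2) f assms(4) _ _ _ assms(12,13)])
  have "finite_measure M"
    using assms(6) by (simp add: planar_brownian_motion_def prob_space.finite_measure)
  then have "AE w in arclength_on (f ` \<gamma>).
      \<rho>' w = (\<Sum>\<^sub>\<infinity>z\<in>f -` {w} \<inter> \<gamma>. \<rho> z / ennreal (norm (deriv f z)))"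
    if "has_arclength_density M (\<lambda>\<omega>. f (stopped_at B \<tau> \<omega>)) (f ` \<gamma>) \<rho>'" for \<rho>'
    using arclength_density_unique that dens by blast
  moreover have "AE \<omega> in M. f (stopped_at B \<tau> \<omega>) \<in> f ` \<gamma>"
    using assms(12) by (auto elim!: eventually_mono)
  ultimately show ?thesis using dens by blast
qed

end
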